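(* Let $\Omega\subset\mathbb{H}$ be open and convex, let $u:\Omega\to\mathbb{R}$ be a convex function, and let $g\in\Omega$. Then $\mathbb{X}u(g)$ exists (that is, both $Xu(g)$ and $Yu(g)$ exist) if and only if $u$ has a unique H-subgradient at $g$. Moreover, in both cases, $\partial_H u(g)=\{\mathbb{X}u(g)\}$.
   Context: The Heisenberg group $\mathbb{H}$ is $\mathbb{R}^3$ with the group law $(x,y,t)(x',y',t')=(x+x',\,y+y',\,t+t'+2(x'y-xy'))$, identity $e=(0,0,0)$, and dilations $\delta_\lambda(x,y,t)=(\lambda x,\lambda y,\lambda^2 t)$. Let $X=\partial_x+2y\,\partial_t$, $Y=\partial_y-2x\,\partial_t$ and $V_1=\mathrm{span}\{X,Y\}$, with the inner product $\langle\cdot,\cdot\rangle$ for which $X,Y$ are orthonormal. For $v=\alpha X+\beta Y\in V_1$, $\exp(v)=(\alpha,\beta,0)$; and $\xi_1(x,y,t)=xX+yY\in V_1$. For $g_0=(x_0,y_0,t_0)\in\mathbb{H}$ the horizontal plane at $g_0$ is $H_{g_0}=\{g_0\exp(v): v\in V_1\}=\{(x,y,t): t=t_0+2y_0x-2x_0y\}$. The horizontal derivatives are $Xu(g)=\lim_{\lambda\to0}\frac{u(g\exp(\lambda X))-u(g)}{\lambda}$ and $Yu(g)=\lim_{\lambda\to0}\frac{u(g\exp(\lambda Y))-u(g)}{\lambda}$, when these limits exist, and $\mathbb{X}u=(Xu)X+(Yu)Y\in V_1$. A set $\Omega\subset\mathbb{H}$ is convex if for every $g\in\Omega$ and $g'\in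 H_g\cap\Omega$ one has $g\delta_\lambda(g^{-1}g')\in\Omega$ for all $\lambda\in[0,1]$. A function $u:\Omega\to\mathbb{R}$ on a convex set $\Omega$ is convex if $u(g\delta_\lambda(g^{-1}g'))\le u(g)+\lambda(u(g')-u(g))$ for all $g\in\Omega$, $g'\in H_g\cap\Omega$, $\lambda\in[0,1]$. The H-subdifferential of $u:\Omega\to\mathbb{R}$ at $g_0\in\Omega$ is $\partial_H u(g_0)=\{p\in V_1:\ u(g)\ge u(g_0)+\langle p,\xi_1(g)-\xi_1(g_0)\rangle\ \ \forall g\in H_{g_0}\cap\Omega\}$; its elements are called H-subgradients of $u$ at $g_0$. *)

theory Defs
  imports "HOL-Analysis.Analysis"
begin

(* The Heisenberg group on the manifold R^3 with its usual topology. The library's additive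
   structure on triples is not the group law, which is h_mult. *)
type_synonym heis = "real \<times> real \<times> real"

fun h_mult :: "heis \<Rightarrow> heis \<Rightarrow> heis"  (infixl "\<cdot>\<^sub>H" 70) where
  "(x, y, t) \<cdot>\<^sub>H (x', y', t') = (x + x', y + y', t + t' + 2 * (x' * y - x * y'))"

definition h_one :: heis where
  "h_one = (0, 0, 0)"

fun h_inv :: "heis \<Rightarrow> heis" where
  "h_inv (x, y, t) = (- x, - y, - t)"

lemma heis_group: "group h_mult h_one h_inv"
  by unfold_locales (auto simp: h_one_def algebra_simps)

fun h_dil :: "real \<Rightarrow> heis \<Rightarrow> heis"  ("\<delta>\<^sub>H") where
  "\<delta>\<^sub>H r (x, y, t) = (r * x, r * y, r\<^sup>2 * t)"

(* The first layer V_1 = span {X, Y}: the pair (a, b) stands for the left-invariant vector field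
   a X + b Y. The library inner product on pairs is then the one for which X and Y are
   orthonormal. That the basis vectors below generate the fields X = d/dx + 2y d/dt and
   Y = d/dy - 2x d/dt is the content of X_field_eq and Y_field_eq. *)
type_synonym layer1 = "real \<times> real"

definition X_field :: layer1 where "X_field = (1, 0)"
definition Y_field :: layer1 where "Y_field = (0, 1)"

fun h_exp :: "layer1 \<Rightarrow> heis" where
  "h_exp (a, b) = (a, b, 0)"

lemma X_field_eq:
  "((\<lambda>s. (x, y, t) \<cdot>\<^sub>H h_exp (s *\<^sub>R X_field)) has_vector_derivative (1, 0, 2 * y)) (at 0)"
  unfolding X_field_def
  by (auto intro!: derivative_eq_intros has_vector_derivative_Pair
        simp: has_real_derivative_iff_has_vector_derivative[symmetric])

lemma Y_field_eq:
  "((\<lambda>s. (x, y, t) \<cdot>\<^sub>H h_exp (s *\<^sub>R Y_field)) has_vector_derivative (0, 1, - 2 * x)) (at 0)"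
  unfolding Y_field_def
  by (auto intro!: derivative_eq_intros has_vector_derivative_Pair
        simp: has_real_derivative_iff_has_vector_derivative[symmetric])

fun xi1 :: "heis \<Rightarrow> layer1"  ("\<xi>\<^sub>1") where
  "\<xi>\<^sub>1 (x, y, t) = x *\<^sub>R X_field + y *\<^sub>R Y_field"

definition h_plane :: "heis \<Rightarrow> heis set" where
  "h_plane g = {g \<cdot>\<^sub>H h_exp v | v. True}"

lemma h_plane_eq:
  "h_plane (x0, y0, t0) = {(x, y, t). t = t0 + 2 * y0 * x - 2 * x0 * y}"
proof (intro set_eqI iffI)
  fix g assume "g \<in> {(x, y, t). t = t0 + 2 * y0 * x - 2 * x0 * y}"
  then have "g = (x0, y0, t0) \<cdot>\<^sub>H h_exp (fst g - x0, fst (snd g) - y0)"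
    by (auto simp: algebra_simps)
  then show "g \<in> h_plane (x0, y0, t0)" unfolding h_plane_def by blast
qed (auto simp: h_plane_def algebra_simps)

(* A function u on Omega is rendered as a total function whose values outside Omega play no role:
   the notions below only evaluate u on Omega, except for the limits defining the horizontal
   derivatives at g, which for an open Omega containing g depend only on u near g. *)

definition h_diff_quot :: "layer1 \<Rightarrow> (heis \<Rightarrow> real) \<Rightarrow> heis \<Rightarrow> real \<Rightarrow> real" where
  "h_diff_quot v u g = (\<lambda>r. (u (g \<cdot>\<^sub>H h_exp (r *\<^sub>R v)) - u g) / r)"

definition X_differentiable :: "(heis \<Rightarrow> real) \<Rightarrow> heis \<Rightarrow> bool" where
  "X_differentiable u g \<longleftrightarrow> (\<exists>d. (h_diff_quot X_field u g \<longlongrightarrow> d) (at 0))"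

definition Y_differentiable :: "(heis \<Rightarrow> real) \<Rightarrow> heis \<Rightarrow> bool" where
  "Y_differentiable u g \<longleftrightarrow> (\<exists>d. (h_diff_quot Y_field u g \<longlongrightarrow> d) (at 0))"

definition X_deriv :: "(heis \<Rightarrow> real) \<Rightarrow> heis \<Rightarrow> real" where
  "X_deriv u g = Lim (at 0) (h_diff_quot X_field u g)"

definition Y_deriv :: "(heis \<Rightarrow> real) \<Rightarrow> heis \<Rightarrow> real" where
  "Y_deriv u g = Lim (at 0) (h_diff_quot Y_field u g)"

(* Meaningful only if u is X- and Y-differentiable at g. *)
definition h_grad :: "(heis \<Rightarrow> real) \<Rightarrow> heis \<Rightarrow> layer1" where
  "h_grad u g = X_deriv u g *\<^sub>R X_field + Y_deriv u g *\<^sub>R Y_field"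

definition h_convex :: "heis set \<Rightarrow> bool" where
  "h_convex \<Omega> \<longleftrightarrow>
    (\<forall>g\<in>\<Omega>. \<forall>g'\<in>h_plane g \<inter> \<Omega>. \<forall>r\<in>{0..1}. g \<cdot>\<^sub>H \<delta>\<^sub>H r (h_inv g \<cdot>\<^sub>H g') \<in> \<Omega>)"

definition h_convex_on :: "heis set \<Rightarrow> (heis \<Rightarrow> real) \<Rightarrow> bool" where
  "h_convex_on \<Omega> u \<longleftrightarrow> h_convex \<Omega> \<and>
    (\<forall>g\<in>\<Omega>. \<forall>g'\<in>h_plane g \<inter> \<Omega>. \<forall>r\<in>{0..1}.
      u (g \<cdot>\<^sub>H \<delta>\<^sub>H r (h_inv g \<cdot>\<^sub>H g')) \<le> u g + r * (u g' - u g))"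

definition h_subdiff :: "heis set \<Rightarrow> (heis \<Rightarrow> real) \<Rightarrow> heis \<Rightarrow> layer1 set" where
  "h_subdiff \<Omega> u g0 =
    {p. \<forall>g\<in>h_plane g0 \<inter> \<Omega>. u g \<ge> u g0 + inner p (\<xi>\<^sub>1 g - \<xi>\<^sub>1 g0)}"

end

theory Submission
  imports Defs
begin

text \<open>
  A convex function on an open set is continuous: the iterated horizontal convex hull of finitely
  many points contains a neighbourhood of any given point, so the function is locally bounded
  above, and convexity along horizontal lines then controls its oscillation along a commutator path.
  The restriction of \<open>u\<close> to the horizontal plane at \<open>g\<close> is convex only along the lines through
  \<open>g\<close>. Its directional derivative \<open>D\<close> at \<open>g\<close> is nevertheless sublinear, because
  \<open>exp v exp 2w exp v = exp 2(v + w)\<close>: the increments along the three pieces of a short path of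
  this shape are bounded by difference quotients of fixed step size, which are continuous in the
  base point. The subdifferential consists of the linear functionals below \<open>D\<close>, so by Hahn-Banach
  it is a singleton iff \<open>D\<close> is linear, that is, odd on \<open>X\<close> and on \<open>Y\<close>.
\<close>

section \<open>Horizontal segments\<close>

lemma h_mult_assoc: "(p \<cdot>\<^sub>H q) \<cdot>\<^sub>H r = p \<cdot>\<^sub>H (q \<cdot>\<^sub>H r)"
  by (cases p; cases q; cases r) (simp add: algebra_simps)

lemma h_inv_mult_cancel: "h_inv p \<cdot>\<^sub>H (p \<cdot>\<^sub>H q) = q"
  by (cases p; cases q) (simp add: algebra_simps)

lemma h_mult_inv_cancel: "p \<cdot>\<^sub>H (h_inv p \<cdot>\<^sub>H q) = q"
  by (cases p; cases q) (simp add: algebra_simps)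

lemma h_mult_exp_zero [simp]: "p \<cdot>\<^sub>H h_exp 0 = p"
  by (cases p) (simp add: zero_prod_def)

lemma h_mult_one [simp]: "p \<cdot>\<^sub>H h_one = p"
  by (cases p) (simp add: h_one_def)

lemma h_exp_add_same: "p \<cdot>\<^sub>H h_exp (r *\<^sub>R w) \<cdot>\<^sub>H h_exp (s *\<^sub>R w) = p \<cdot>\<^sub>H h_exp ((r + s) *\<^sub>R w)"
  by (cases p; cases w) (simp add: algebra_simps)

text \<open>The first and the last factor shear the centre by opposite amounts, so the product stays
  in the horizontal plane at \<open>p\<close>.\<close>

lemma h_exp_symmetric_product:
  "p \<cdot>\<^sub>H h_exp v \<cdot>\<^sub>H h_exp (2 *\<^sub>R w) \<cdot>\<^sub>H h_exp v = p \<cdot>\<^sub>H h_exp (2 *\<^sub>R (v + w))"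
  by (cases p; cases v; cases w) (simp add: algebra_simps)

lemma h_dil_exp: "\<delta>\<^sub>H r (h_exp w) = h_exp (r *\<^sub>R w)"
  by (cases w) simp

lemma xi1_exp_diff: "\<xi>\<^sub>1 (p \<cdot>\<^sub>H h_exp w) - \<xi>\<^sub>1 p = w"
  by (cases p; cases w) (simp add: X_field_def Y_field_def)

lemma ball_h_plane:
  "(\<forall>q\<in>h_plane p \<inter> C. P q) \<longleftrightarrow> (\<forall>w. p \<cdot>\<^sub>H h_exp w \<in> C \<longrightarrow> P (p \<cdot>\<^sub>H h_exp w))"
  unfolding h_plane_def by blast

text \<open>Writing the second point as \<open>p\<close> times \<open>h_exp w\<close> turns the
  conjugated dilation of the definition into a plain scaling of \<open>w\<close>.\<close>

lemma h_convex_iff: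
  "h_convex C \<longleftrightarrow> (\<forall>p w. \<forall>r\<in>{0..1}. p \<in> C \<longrightarrow> p \<cdot>\<^sub>H h_exp w \<in> C \<longrightarrow> p \<cdot>\<^sub>H h_exp (r *\<^sub>R w) \<in> C)"
  unfolding h_convex_def ball_h_plane h_inv_mult_cancel h_dil_exp by blast

lemma h_convex_on_iff:
  "h_convex_on \<Omega> u \<longleftrightarrow> h_convex \<Omega> \<and>
    (\<forall>p w. \<forall>r\<in>{0..1}. p \<in> \<Omega> \<longrightarrow> p \<cdot>\<^sub>H h_exp w \<in> \<Omega> \<longrightarrow>
      u (p \<cdot>\<^sub>H h_exp (r *\<^sub>R w)) \<le> u p + r * (u (p \<cdot>\<^sub>H h_exp w) - u p))"
  unfolding h_convex_on_def ball_h_plane h_inv_mult_cancel h_dil_exp by blast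

text \<open>Left translations carry horizontal segments to horizontal segments, so hull computations
  can be done around the identity.\<close>

lemma h_convex_translate:
  assumes "h_convex C"
  shows "h_convex {h. q \<cdot>\<^sub>H h \<in> C}"
  using assms unfolding h_convex_iff by (simp del: split_paired_All flip: h_mult_assoc)

text \<open>Through this, a bound at finitely many points passes to their whole iterated horizontal
  hull.\<close>

lemma h_convex_sublevel:
  assumes "h_convex_on \<Omega> u"
  shows "h_convex {p \<in> \<Omega>. u p \<le> M}"
proof -
  have "u (p \<cdot>\<^sub>H h_exp (r *\<^sub>R w)) \<le> M"
    if "r \<in> {0..1}" "p \<in> \<Omega>" "p \<cdot>\<^sub>H h_exp w \<in> \<Omega>" "u p \<le> M" "u (p \<cdot>\<^sub>H h_exp w) \<le> M" for p w r
  proof -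
    have "u (p \<cdot>\<^sub>H h_exp (r *\<^sub>R w)) \<le> u p + r * (u (p \<cdot>\<^sub>H h_exp w) - u p)"
      using assms that unfolding h_convex_on_iff by blast
    also have "\<dots> = (1 - r) * u p + r * u (p \<cdot>\<^sub>H h_exp w)"
      by (simp add: algebra_simps)
    also have "\<dots> \<le> (1 - r) * M + r * M"
      using that by (intro add_mono mult_left_mono) auto
    finally show ?thesis by (simp add: algebra_simps)
  qed
  then show ?thesis
    using assms unfolding h_convex_on_iff h_convex_iff mem_Collect_eq by blast
qed

text \<open>The base point is the middle one because the hull arguments start from the target and
  construct the endpoints; it divides the segment at the fraction
  \<open>\<alpha> / (\<alpha> + \<beta>)\<close>.\<close>

lemma h_convex_between:
  assumes "h_convex C" "0 \<le> \<alpha>" "0 \<le> \<beta>"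
    and "p \<cdot>\<^sub>H h_exp ((- \<alpha>) *\<^sub>R w) \<in> C" "p \<cdot>\<^sub>H h_exp (\<beta> *\<^sub>R w) \<in> C"
  shows "p \<in> C"
proof (cases "\<alpha> + \<beta> = 0")
  case True
  then have "\<alpha> = 0" using assms by linarith
  then show ?thesis using assms by simp
next
  case False
  then have "0 < \<alpha> + \<beta>" using assms by linarith
  then have "\<alpha> / (\<alpha> + \<beta>) \<in> {0..1}" using assms by simp
  let ?q = "p \<cdot>\<^sub>H h_exp ((- \<alpha>) *\<^sub>R w)"
  have "?q \<cdot>\<^sub>H h_exp ((\<alpha> + \<beta>) *\<^sub>R w) \<in> C"
    using assms by (simp only: h_exp_add_same) simp
  then have "?q \<cdot>\<^sub>H h_exp ((\<alpha> / (\<alpha> + \<beta>)) *\<^sub>R (\<alpha> + \<beta>) *\<^sub>R w) \<in> C"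
    using assms \<open>\<alpha> / (\<alpha> + \<beta>) \<in> {0..1}\<close> unfolding h_convex_iff by blast
  moreover have "?q \<cdot>\<^sub>H h_exp ((\<alpha> / (\<alpha> + \<beta>)) *\<^sub>R (\<alpha> + \<beta>) *\<^sub>R w) = p"
    using False by (simp only: scaleR_scaleR h_exp_add_same) simp
  ultimately show ?thesis by simp
qed

text \<open>Along the \<open>X\<close>-line through \<open>(x, y, t)\<close> the central coordinate
  has constant slope \<open>2 * y\<close>.\<close>

lemma h_convex_between_X:
  assumes "h_convex C" "x1 \<le> x" "x \<le> x2"
    and "(x1, y, t + 2 * y * (x1 - x)) \<in> C" "(x2, y, t + 2 * y * (x2 - x)) \<in> C"
  shows "(x, y, t) \<in> C"
  by (rule h_convex_between[where \<alpha> = "x - x1" and \<beta> = "x2 - x" and w = "(1, 0)"])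
    (use assms in \<open>simp_all add: algebra_simps\<close>)

lemma h_convex_between_Y:
  assumes "h_convex C" "y1 \<le> y" "y \<le> y2"
    and "(x, y1, t - 2 * x * (y1 - y)) \<in> C" "(x, y2, t - 2 * x * (y2 - y)) \<in> C"
  shows "(x, y, t) \<in> C"
  by (rule h_convex_between[where \<alpha> = "y - y1" and \<beta> = "y2 - y" and w = "(0, 1)"])
    (use assms in \<open>simp_all add: algebra_simps\<close>)

section \<open>Continuity of convex functions\<close>

text \<open>The four points span two segments in direction \<open>X\<close>, at heights \<open>y = - S\<close> and \<open>y = S\<close>;
  the points over \<open>s\<close> and \<open>- s\<close> on them lie on a common horizontal line, whose midpoint is
  \<open>(0, 0, - 2 S s)\<close>.\<close>

lemma h_convex_contains_vertical:
  assumes C: "h_convex C" and "0 < S"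
    and pts: "\<And>\<sigma> \<rho>. \<sigma> \<in> {-1, 1} \<Longrightarrow> \<rho> \<in> {-1, 1} \<Longrightarrow> (\<sigma> * S, \<rho> * S, 2 * \<sigma> * \<rho> * S\<^sup>2) \<in> C"
    and \<tau>: "\<bar>\<tau>\<bar> \<le> 2 * S\<^sup>2"
  shows "(0, 0, \<tau>) \<in> C"
proof -
  \<comment> \<open>This makes the midpoint \<open>(0, 0, - 2 * S * s)\<close> the target; the bound
    on \<open>\<tau>\<close> then says exactly that \<open>s\<close> and \<open>- s\<close> stay on
    the two segments.\<close>
  define s where "s = - \<tau> / (2 * S)"
  have \<tau>_eq: "\<tau> = - 2 * S * s" using \<open>0 < S\<close> by (simp add: s_def)
  have "2 * S * \<bar>s\<bar> \<le> 2 * S * S"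
    using \<tau> \<open>0 < S\<close> unfolding \<tau>_eq abs_mult power2_eq_square by simp
  then have "\<bar>s\<bar> \<le> S" using \<open>0 < S\<close> by simp
  then have s: "- S \<le> s" "s \<le> S" "- S \<le> - s" "- s \<le> S" by linarith+
  have t: "\<tau> + 2 * (- S) * (- S - s) = 2 * S\<^sup>2" "\<tau> + 2 * (- S) * (S - s) = - (2 * S\<^sup>2)"
    "\<tau> + 2 * S * (- S - - s) = - (2 * S\<^sup>2)" "\<tau> + 2 * S * (S - - s) = 2 * S\<^sup>2"
    unfolding \<tau>_eq by (simp_all add: algebra_simps power2_eq_square)
  have C4: "(- S, - S, 2 * S\<^sup>2) \<in> C" "(S, - S, - (2 * S\<^sup>2)) \<in> C"
    "(- S, S, - (2 * S\<^sup>2)) \<in> C" "(S, S, 2 * S\<^sup>2) \<in> C"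
    using pts[of "-1" "-1"] pts[of 1 "-1"] pts[of "-1" 1] pts[of 1 1] by simp_all
  have "(s, - S, \<tau>) \<in> C"
    by (rule h_convex_between_X[OF C s(1,2)]; unfold t) (rule C4)+
  moreover have "(- s, S, \<tau>) \<in> C"
    by (rule h_convex_between_X[OF C s(3,4)]; unfold t) (rule C4)+
  ultimately have "(0, 0, \<tau>) \<cdot>\<^sub>H h_exp ((- 1) *\<^sub>R (- s, S)) \<in> C" "(0, 0, \<tau>) \<cdot>\<^sub>H h_exp (1 *\<^sub>R (- s, S)) \<in> C"
    by simp_all
  then show ?thesis
    by (rule h_convex_between[OF C zero_le_one zero_le_one])
qed

text \<open>For each corner \<open>(c a, d a)\<close> of a square, the four points that produce a vertical segment over
  it; vertical segments over the corners, long compared with \<open>a\<^sup>2\<close>, have a box in their horizontal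
  hull.\<close>

definition hull_point :: "real \<Rightarrow> real \<times> real \<times> real \<times> real \<Rightarrow> heis" where
  "hull_point a = (\<lambda>(c, d, \<sigma>, \<rho>).
    (c * a, d * a, 0) \<cdot>\<^sub>H (\<sigma> * (4 * a), \<rho> * (4 * a), 2 * \<sigma> * \<rho> * (4 * a)\<^sup>2))"

definition sign_set :: "(real \<times> real \<times> real \<times> real) set" where
  "sign_set = {-1, 1} \<times> {-1, 1} \<times> {-1, 1} \<times> {-1, 1}"

text \<open>The point lies on a \<open>Y\<close>-line between the edges at heights
  \<open>- a\<close> and \<open>a\<close>, and each edge point on an \<open>X\<close>-line between
  two corner verticals. Either slide shifts the centre by at most \<open>4 * a\<^sup>2\<close>:
  verticals of half-length \<open>2 * (4 * a)\<^sup>2 = 32 * a\<^sup>2\<close> leave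
  \<open>28 * a\<^sup>2\<close> on the edges, where \<open>5 * a\<^sup>2\<close> suffices.\<close>

lemma h_convex_contains_box:
  assumes C: "h_convex C" and "0 < a"
    and pts: "hull_point a ` sign_set \<subseteq> C"
    and "\<bar>x\<bar> \<le> a" "\<bar>y\<bar> \<le> a" "\<bar>t\<bar> \<le> a\<^sup>2"
  shows "(x, y, t) \<in> C"
proof -
  have vert: "(c * a, d * a, \<tau>) \<in> C" if "c \<in> {-1, 1}" "d \<in> {-1, 1}" "\<bar>\<tau>\<bar> \<le> 32 * a\<^sup>2" for c d \<tau>
  proof -
    have "(0, 0, \<tau>) \<in> {h. (c * a, d * a, 0) \<cdot>\<^sub>H h \<in> C}"
    proof (rule h_convex_contains_vertical[OF h_convex_translate[OF C], where S = "4 * a"])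
      fix \<sigma> \<rho> :: real assume "\<sigma> \<in> {-1, 1}" "\<rho> \<in> {-1, 1}"
      then have "(c, d, \<sigma>, \<rho>) \<in> sign_set"
        using that unfolding sign_set_def by blast
      then have "hull_point a (c, d, \<sigma>, \<rho>) \<in> C" using pts by blast
      then show "(\<sigma> * (4 * a), \<rho> * (4 * a), 2 * \<sigma> * \<rho> * (4 * a)\<^sup>2) \<in> {h. (c * a, d * a, 0) \<cdot>\<^sub>H h \<in> C}"
        by (simp add: hull_point_def)
    qed (use that \<open>0 < a\<close> in \<open>auto simp: power_mult_distrib\<close>)
    then show ?thesis by simp
  qed
  have shear: "\<bar>s + 2 * b * e\<bar> \<le> N + 4 * a\<^sup>2" "\<bar>s - 2 * b * e\<bar> \<le> N + 4 * a\<^sup>2"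
    if "\<bar>s\<bar> \<le> N" "\<bar>b\<bar> \<le> a" "\<bar>e\<bar> \<le> 2 * a" for s b e N
  proof -
    have "\<bar>b\<bar> * \<bar>e\<bar> \<le> a * (2 * a)" using that by (intro mult_mono) auto
    then have "\<bar>2 * b * e\<bar> \<le> 4 * a\<^sup>2" by (simp add: abs_mult power2_eq_square)
    with that(1) show "\<bar>s + 2 * b * e\<bar> \<le> N + 4 * a\<^sup>2" "\<bar>s - 2 * b * e\<bar> \<le> N + 4 * a\<^sup>2"
      by linarith+
  qed
  \<comment> \<open>The endpoints are written \<open>- 1 * a\<close> and \<open>1 * a\<close> to
    match the corner form \<open>c * a\<close> in \<open>vert\<close>.\<close>
  have range: "\<bar>- 1 * a - z\<bar> \<le> 2 * a" "\<bar>1 * a - z\<bar> \<le> 2 * a" "- 1 * a \<le> z" "z \<le> 1 * a"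
    if "\<bar>z\<bar> \<le> a" for z
    using that by linarith+
  have edge: "(x, d * a, s) \<in> C" if "d \<in> {-1, 1}" and s: "\<bar>s\<bar> \<le> 28 * a\<^sup>2" for d s
  proof (rule h_convex_between_X[OF C, of "- 1 * a" _ "1 * a"])
    have da: "\<bar>d * a\<bar> \<le> a" using that \<open>0 < a\<close> by auto
    show "(- 1 * a, d * a, s + 2 * (d * a) * (- 1 * a - x)) \<in> C"
      using shear(1)[OF s da range(1)[OF \<open>\<bar>x\<bar> \<le> a\<close>]] \<open>d \<in> {-1, 1}\<close> by (intro vert) auto
    show "(1 * a, d * a, s + 2 * (d * a) * (1 * a - x)) \<in> C"
      using shear(1)[OF s da range(2)[OF \<open>\<bar>x\<bar> \<le> a\<close>]] \<open>d \<in> {-1, 1}\<close> by (intro vert) auto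
  qed (use range(3,4) \<open>\<bar>x\<bar> \<le> a\<close> in blast)+
  have le: "a\<^sup>2 + 4 * a\<^sup>2 \<le> 28 * a\<^sup>2" by simp
  show ?thesis
  proof (rule h_convex_between_Y[OF C, of "- 1 * a" _ "1 * a"])
    show "(x, - 1 * a, t - 2 * x * (- 1 * a - y)) \<in> C"
      by (intro edge order_trans[OF shear(2) le] range assms) simp
    show "(x, 1 * a, t - 2 * x * (1 * a - y)) \<in> C"
      by (intro edge order_trans[OF shear(2) le] range assms) simp
  qed (use range(3,4) \<open>\<bar>y\<bar> \<le> a\<close> in blast)+
qed

lemma tendsto_h_mult [tendsto_intros]:
  assumes "(p \<longlongrightarrow> a) F" "(q \<longlongrightarrow> b) F"
  shows "((\<lambda>x. p x \<cdot>\<^sub>H q x) \<longlongrightarrow> a \<cdot>\<^sub>H b) F"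
proof -
  have eq: "g \<cdot>\<^sub>H h = (fst g + fst h, fst (snd g) + fst (snd h),
    snd (snd g) + snd (snd h) + 2 * (fst h * fst (snd g) - fst g * fst (snd h)))" for g h
    by (cases g; cases h) simp
  show ?thesis unfolding eq by (intro tendsto_intros assms)
qed

lemma tendsto_h_exp [tendsto_intros]:
  assumes "(w \<longlongrightarrow> v) F"
  shows "((\<lambda>x. h_exp (w x)) \<longlongrightarrow> h_exp v) F"
proof -
  have eq: "h_exp z = (fst z, snd z, 0)" for z by (cases z) simp
  show ?thesis unfolding eq by (intro tendsto_intros assms)
qed

locale h_convex_function =
  fixes \<Omega> :: "heis set" and u :: "heis \<Rightarrow> real"
  assumes open_dom: "open \<Omega>" and h_convex_on: "h_convex_on \<Omega> u"
begin

lemma segment_in_dom: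
  assumes "p \<in> \<Omega>" "p \<cdot>\<^sub>H h_exp w \<in> \<Omega>" "0 \<le> r" "r \<le> 1"
  shows "p \<cdot>\<^sub>H h_exp (r *\<^sub>R w) \<in> \<Omega>"
  using h_convex_on assms by (simp add: h_convex_on_iff h_convex_iff del: split_paired_All)

lemma segment_le:
  assumes "p \<in> \<Omega>" "p \<cdot>\<^sub>H h_exp w \<in> \<Omega>" "0 \<le> r" "r \<le> 1"
  shows "u (p \<cdot>\<^sub>H h_exp (r *\<^sub>R w)) \<le> u p + r * (u (p \<cdot>\<^sub>H h_exp w) - u p)"
  using h_convex_on assms by (simp add: h_convex_on_iff del: split_paired_All)

lemma eventually_in_dom:
  assumes "(p \<longlongrightarrow> g) F" "g \<in> \<Omega>"
  shows "eventually (\<lambda>x. p x \<in> \<Omega>) F"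
  using topological_tendstoD[OF assms(1) open_dom assms(2)] .

text \<open>As \<open>a\<close> tends to 0 the sixteen hull points collapse to the identity, so for
  some \<open>a > 0\<close> their translates by \<open>g\<close> lie in the domain. The sublevel set
  at their largest value is convex, hence contains a translated box.\<close>

lemma locally_bounded_above:
  assumes "g \<in> \<Omega>"
  obtains M where "eventually (\<lambda>h. h \<in> \<Omega> \<and> u h \<le> M) (nhds g)"
proof -
  have "finite sign_set" by (simp add: sign_set_def)
  have "eventually (\<lambda>a. g \<cdot>\<^sub>H hull_point a s \<in> \<Omega>) (at_right 0)" for s
  proof (rule eventually_in_dom[OF _ assms])
    obtain c d \<sigma> \<rho> where s: "s = (c, d, \<sigma>, \<rho>)" by (cases s)
    have "((\<lambda>a. g \<cdot>\<^sub>H hull_point a s) \<longlongrightarrow> g \<cdot>\<^sub>H hull_point 0 s) (at_right 0)"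
      unfolding hull_point_def s prod.case by (intro tendsto_intros)
    moreover have "hull_point 0 s = h_one" by (simp add: hull_point_def s h_one_def)
    ultimately show "((\<lambda>a. g \<cdot>\<^sub>H hull_point a s) \<longlongrightarrow> g) (at_right 0)" by simp
  qed
  then have "eventually (\<lambda>a. \<forall>s\<in>sign_set. g \<cdot>\<^sub>H hull_point a s \<in> \<Omega>) (at_right 0)"
    using \<open>finite sign_set\<close> by (simp add: eventually_ball_finite)
  then have "eventually (\<lambda>a. 0 < a \<and> (\<forall>s\<in>sign_set. g \<cdot>\<^sub>H hull_point a s \<in> \<Omega>)) (at_right 0)"
    by (intro eventually_conj eventually_at_right_less)
  then obtain a where a: "0 < a" "\<And>s. s \<in> sign_set \<Longrightarrow> g \<cdot>\<^sub>H hull_point a s \<in> \<Omega>"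
    using eventually_happens'[OF trivial_limit_at_right_real] by blast
  define M where "M = Max ((\<lambda>s. u (g \<cdot>\<^sub>H hull_point a s)) ` sign_set)"
  let ?C = "{h. g \<cdot>\<^sub>H h \<in> {p \<in> \<Omega>. u p \<le> M}}"
  have "hull_point a ` sign_set \<subseteq> ?C"
    using a \<open>finite sign_set\<close> by (auto simp: M_def)
  then have box: "(x, y, t) \<in> ?C" if "\<bar>x\<bar> \<le> a" "\<bar>y\<bar> \<le> a" "\<bar>t\<bar> \<le> a\<^sup>2" for x y t
    using h_convex_contains_box[OF h_convex_translate[OF h_convex_sublevel[OF h_convex_on]] \<open>0 < a\<close>] that
    by blast
  \<comment> \<open>The box surrounds the identity; continuity of left translation turns it into a
    neighbourhood of \<open>g\<close>.\<close>
  have lim: "((\<lambda>h. h_inv g \<cdot>\<^sub>H h) \<longlongrightarrow> (0, 0, 0)) (nhds g)"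
  proof -
    have "((\<lambda>h. h_inv g \<cdot>\<^sub>H h) \<longlongrightarrow> h_inv g \<cdot>\<^sub>H g) (nhds g)"
      by (intro tendsto_intros filterlim_ident)
    moreover have "h_inv g \<cdot>\<^sub>H g = (0, 0, 0)" by (cases g) simp
    ultimately show ?thesis by simp
  qed
  have "open ({-a<..<a} \<times> {-a<..<a} \<times> {-(a\<^sup>2)<..<a\<^sup>2})"
    by (intro open_Times open_greaterThanLessThan)
  then have "eventually (\<lambda>h. h_inv g \<cdot>\<^sub>H h \<in> {-a<..<a} \<times> {-a<..<a} \<times> {-(a\<^sup>2)<..<a\<^sup>2}) (nhds g)"
    using \<open>0 < a\<close> by (intro topological_tendstoD[OF lim]) auto
  then have "eventually (\<lambda>h. h \<in> \<Omega> \<and> u h \<le> M) (nhds g)"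
  proof eventually_elim
    case (elim h)
    obtain x y t where xyt: "h_inv g \<cdot>\<^sub>H h = (x, y, t)" by (cases "h_inv g \<cdot>\<^sub>H h")
    with elim have "g \<cdot>\<^sub>H (x, y, t) \<in> {p \<in> \<Omega>. u p \<le> M}"
      using box[of x y t] by auto
    then show ?case by (simp add: h_mult_inv_cancel flip: xyt)
  qed
  then show thesis ..
qed

text \<open>An upper bound at the far points \<open>k\<close> and \<open>- k\<close> controls the
  unit step in both directions, with a gain of the factor \<open>k\<close>.\<close>

lemma oscillation_le:
  assumes M: "\<And>s. s \<in> {0, 1, k, - k} \<Longrightarrow> p \<cdot>\<^sub>H h_exp (s *\<^sub>R w) \<in> \<Omega> \<and> u (p \<cdot>\<^sub>H h_exp (s *\<^sub>R w)) \<le> M"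
    and k: "1 \<le> k"
  shows "\<bar>u (p \<cdot>\<^sub>H h_exp w) - u p\<bar> \<le> (M - u p) / k"
proof -
  let ?q = "p \<cdot>\<^sub>H h_exp w"
  have p: "p \<in> \<Omega>" using M[of 0] by simp
  have q: "?q \<in> \<Omega>" using M[of 1] by simp
  have "u ?q \<le> u p + (1 / k) * (u (p \<cdot>\<^sub>H h_exp (k *\<^sub>R w)) - u p)"
    using segment_le[OF p, of "k *\<^sub>R w" "1 / k"] M[of k] k by simp
  also have "\<dots> \<le> u p + (1 / k) * (M - u p)"
    using M[of k] k by (intro add_left_mono mult_left_mono) auto
  finally have upper: "u ?q - u p \<le> (M - u p) / k" by simp
  have flow: "?q \<cdot>\<^sub>H h_exp (s *\<^sub>R w) = p \<cdot>\<^sub>H h_exp ((1 + s) *\<^sub>R w)" for s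
    using h_exp_add_same[of p 1 w s] by simp
  \<comment> \<open>Seen from \<open>?q\<close>, the point \<open>p\<close> is the fraction
    \<open>1 / (k + 1)\<close> of the way to the far point at \<open>- k\<close>; this bounds
    \<open>u p\<close> above, hence \<open>u ?q\<close> below.\<close>
  have "u (?q \<cdot>\<^sub>H h_exp ((1 / (k + 1)) *\<^sub>R (- (k + 1)) *\<^sub>R w)) \<le>
      u ?q + (1 / (k + 1)) * (u (?q \<cdot>\<^sub>H h_exp ((- (k + 1)) *\<^sub>R w)) - u ?q)"
    by (rule segment_le[OF q]) (use M[of "- k"] k in \<open>simp_all only: flow, auto\<close>)
  moreover have "(1 / (k + 1)) *\<^sub>R (- (k + 1)) *\<^sub>R w = (- 1) *\<^sub>R w"
  proof -
    have "(1 / (k + 1)) * (- (k + 1)) = - 1" using k by (simp add: field_simps)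
    then show ?thesis by (simp only: scaleR_scaleR)
  qed
  ultimately have "u p \<le> u ?q + (1 / (k + 1)) * (u (p \<cdot>\<^sub>H h_exp ((- k) *\<^sub>R w)) - u ?q)"
    by (simp only: flow) simp
  also have "\<dots> \<le> u ?q + (1 / (k + 1)) * (M - u ?q)"
    using M[of "- k"] k by (intro add_left_mono mult_left_mono) auto
  finally have "(k + 1) * u p \<le> (k + 1) * (u ?q + (1 / (k + 1)) * (M - u ?q))"
    using k by (intro mult_left_mono) auto
  also have "\<dots> = k * u ?q + M"
    using k by (simp add: field_simps)
  finally have "u p - u ?q \<le> (M - u p) / k"
    using k by (simp add: field_simps)
  with upper show ?thesis by auto
qed

text \<open>The bound \<open>M\<close> holds uniformly near \<open>g\<close>, and a fixed multiple
  of a vanishing step still vanishes, so \<open>oscillation_le\<close> applies with \<open>k\<close>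
  as large as desired even though the base points move.\<close>

lemma tendsto_exp_step:
  assumes p: "(p \<longlongrightarrow> g) F" and w: "(w \<longlongrightarrow> 0) F" and g: "g \<in> \<Omega>"
    and L: "((\<lambda>x. u (p x)) \<longlongrightarrow> L) F"
  shows "((\<lambda>x. u (p x \<cdot>\<^sub>H h_exp (w x))) \<longlongrightarrow> L) F"
proof -
  obtain M where M: "eventually (\<lambda>h. h \<in> \<Omega> \<and> u h \<le> M) (nhds g)"
    using locally_bounded_above[OF g] .
  have near: "eventually (\<lambda>x. p x \<cdot>\<^sub>H h_exp (s *\<^sub>R w x) \<in> \<Omega> \<and> u (p x \<cdot>\<^sub>H h_exp (s *\<^sub>R w x)) \<le> M) F" for s
  proof -
    have "((\<lambda>x. p x \<cdot>\<^sub>H h_exp (s *\<^sub>R w x)) \<longlongrightarrow> g \<cdot>\<^sub>H h_exp (s *\<^sub>R 0)) F"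
      by (intro tendsto_intros p w)
    then show ?thesis
      using eventually_compose_filterlim[OF M] by simp
  qed
  have "((\<lambda>x. u (p x \<cdot>\<^sub>H h_exp (w x)) - u (p x)) \<longlongrightarrow> 0) F"
  proof (rule tendstoI)
    fix \<epsilon> :: real assume "0 < \<epsilon>"
    \<comment> \<open>Once \<open>u (p x)\<close> is within 1 of \<open>L\<close>, \<open>K\<close>
      bounds \<open>M - u (p x)\<close>; then \<open>k\<close> is chosen to make
      \<open>K / k\<close> less than \<open>\<epsilon>\<close>.\<close>
    define K where "K = \<bar>M - L\<bar> + 1"
    define k where "k = 1 + K / \<epsilon>"
    have "0 < K" by (simp add: K_def)
    then have k: "1 \<le> k" using \<open>0 < \<epsilon>\<close> by (simp add: k_def)
    have "K / k < \<epsilon>" using \<open>0 < K\<close> \<open>0 < \<epsilon>\<close> by (simp add: k_def field_simps)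
    have "eventually (\<lambda>x. \<forall>s\<in>{0, 1, k, - k}.
        p x \<cdot>\<^sub>H h_exp (s *\<^sub>R w x) \<in> \<Omega> \<and> u (p x \<cdot>\<^sub>H h_exp (s *\<^sub>R w x)) \<le> M) F"
      using near by (intro eventually_ball_finite) auto
    moreover have "eventually (\<lambda>x. dist (u (p x)) L < 1) F"
      using tendstoD[OF L] by simp
    ultimately show "eventually (\<lambda>x. dist (u (p x \<cdot>\<^sub>H h_exp (w x)) - u (p x)) 0 < \<epsilon>) F"
    proof eventually_elim
      case (elim x)
      have "\<bar>u (p x \<cdot>\<^sub>H h_exp (w x)) - u (p x)\<bar> \<le> (M - u (p x)) / k"
        using elim(1) by (intro oscillation_le k) blast
      also have "\<dots> \<le> K / k"
        using elim(2) k by (intro divide_right_mono) (auto simp: K_def dist_real_def)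
      finally show ?case using \<open>K / k < \<epsilon>\<close> by simp
    qed
  qed
  from tendsto_add[OF this L] show ?thesis by simp
qed

text \<open>Every point near \<open>g\<close> is reached by five short horizontal segments, the last four
  of which form a commutator moving along the centre.\<close>

lemma tendsto_u:
  assumes p: "(p \<longlongrightarrow> g) F" and g: "g \<in> \<Omega>"
  shows "((\<lambda>x. u (p x)) \<longlongrightarrow> u g) F"
proof -
  define h where "h x = h_inv g \<cdot>\<^sub>H p x" for x
  define \<tau> where "\<tau> x = snd (snd (h x))" for x
  \<comment> \<open>The commutator moves the centre by \<open>- 4 * a x * b x\<close>, which this
    choice makes equal to \<open>\<tau> x\<close>; the square root lets both steps tend to
    0.\<close>
  define a where "a x = sqrt \<bar>\<tau> x\<bar> / 2" for x
  define b where "b x = - sgn (\<tau> x) * a x" for x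
  define v where "v x = (fst (h x), fst (snd (h x)))" for x
  have "(h \<longlongrightarrow> h_inv g \<cdot>\<^sub>H g) F" unfolding h_def by (intro tendsto_intros p)
  moreover have "h_inv g \<cdot>\<^sub>H g = 0" by (cases g) (simp add: zero_prod_def)
  ultimately have h: "(h \<longlongrightarrow> 0) F" by simp
  have \<tau>: "(\<tau> \<longlongrightarrow> 0) F"
    using tendsto_snd[OF tendsto_snd[OF h]] by (simp add: \<tau>_def[abs_def])
  have a: "(a \<longlongrightarrow> 0) F"
    using tendsto_divide[OF tendsto_real_sqrt[OF tendsto_rabs[OF \<tau>]] tendsto_const[of 2]]
    by (simp add: a_def[abs_def])
  have b: "(b \<longlongrightarrow> 0) F"
  proof (rule tendsto_rabs_zero_cancel, rule tendsto_sandwich[where f = "\<lambda>_. 0"])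
    show "eventually (\<lambda>x. \<bar>b x\<bar> \<le> \<bar>a x\<bar>) F"
      by (auto simp: b_def abs_mult sgn_if)
  qed (use tendsto_rabs[OF a] in auto)
  have v: "(v \<longlongrightarrow> 0) F"
    using tendsto_Pair[OF tendsto_fst[OF h] tendsto_fst[OF tendsto_snd[OF h]]]
    by (simp add: v_def[abs_def] zero_prod_def)
  have w: "((\<lambda>x. (a x, 0)) \<longlongrightarrow> 0) F" "((\<lambda>x. (0, b x)) \<longlongrightarrow> 0) F"
      "((\<lambda>x. (- a x, 0)) \<longlongrightarrow> 0) F" "((\<lambda>x. (0, - b x)) \<longlongrightarrow> 0) F"
    using tendsto_Pair[OF a tendsto_const[of 0]] tendsto_Pair[OF tendsto_const[of 0] b]
      tendsto_Pair[OF tendsto_minus[OF a] tendsto_const[of 0]]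
      tendsto_Pair[OF tendsto_const[of 0] tendsto_minus[OF b]]
    by (simp_all add: zero_prod_def)
  \<comment> \<open>Convergence of the points and of the values of \<open>u\<close> is carried along
    together, so that the five segments can be chained.\<close>
  have step: "((\<lambda>x. q x \<cdot>\<^sub>H h_exp (w x)) \<longlongrightarrow> g) F \<and> ((\<lambda>x. u (q x \<cdot>\<^sub>H h_exp (w x))) \<longlongrightarrow> u g) F"
    if "(q \<longlongrightarrow> g) F \<and> ((\<lambda>x. u (q x)) \<longlongrightarrow> u g) F" "(w \<longlongrightarrow> 0) F" for q w
  proof
    have "((\<lambda>x. q x \<cdot>\<^sub>H h_exp (w x)) \<longlongrightarrow> g \<cdot>\<^sub>H h_exp 0) F"
      using that by (intro tendsto_intros) auto
    then show "((\<lambda>x. q x \<cdot>\<^sub>H h_exp (w x)) \<longlongrightarrow> g) F" by simp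
    show "((\<lambda>x. u (q x \<cdot>\<^sub>H h_exp (w x))) \<longlongrightarrow> u g) F"
      by (rule tendsto_exp_step[OF conjunct1[OF that(1)] that(2) g conjunct2[OF that(1)]])
  qed
  have path: "g \<cdot>\<^sub>H h_exp (v x) \<cdot>\<^sub>H h_exp (a x, 0) \<cdot>\<^sub>H h_exp (0, b x) \<cdot>\<^sub>H h_exp (- a x, 0) \<cdot>\<^sub>H h_exp (0, - b x) = p x" for x
  proof -
    have ab: "a x * b x = - \<tau> x / 4"
    proof -
      have "a x * b x = - sgn (\<tau> x) * ((sqrt \<bar>\<tau> x\<bar>)\<^sup>2 / 4)"
        by (simp add: a_def b_def power2_eq_square)
      also have "\<dots> = - (sgn (\<tau> x) * \<bar>\<tau> x\<bar>) / 4" by simp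
      finally show ?thesis by (simp only: sgn_mult_abs)
    qed
    have "h_exp (v x) \<cdot>\<^sub>H (h_exp (a x, 0) \<cdot>\<^sub>H (h_exp (0, b x) \<cdot>\<^sub>H (h_exp (- a x, 0) \<cdot>\<^sub>H h_exp (0, - b x)))) = h x"
      using ab by (cases "h x") (simp add: v_def \<tau>_def algebra_simps)
    then show ?thesis
      by (simp add: h_mult_assoc h_def h_mult_inv_cancel del: h_exp.simps)
  qed
  have "((\<lambda>_. g) \<longlongrightarrow> g) F \<and> ((\<lambda>_. u g) \<longlongrightarrow> u g) F" by simp
  from conjunct2[OF step[OF step[OF step[OF step[OF step[OF this v] w(1)] w(2)] w(3)] w(4)]]
  have "((\<lambda>x. u (g \<cdot>\<^sub>H h_exp (v x) \<cdot>\<^sub>H h_exp (a x, 0) \<cdot>\<^sub>H h_exp (0, b x) \<cdot>\<^sub>H h_exp (- a x, 0) \<cdot>\<^sub>H h_exp (0, - b x))) \<longlongrightarrow> u g) F"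
    .
  then show ?thesis by (simp only: path)
qed

section \<open>Directional derivatives\<close>

definition steps :: "heis \<Rightarrow> layer1 \<Rightarrow> real set" where
  "steps g w = {s. 0 < s \<and> g \<cdot>\<^sub>H h_exp (s *\<^sub>R w) \<in> \<Omega>}"

text \<open>An infimum rather than a limit, so that comparison with each admissible step is
  immediate; \<open>tendsto_dir_deriv\<close> identifies it with the right-hand limit.\<close>

definition dir_deriv :: "heis \<Rightarrow> layer1 \<Rightarrow> real" where
  "dir_deriv g w = (INF s\<in>steps g w. h_diff_quot w u g s)"

lemma eventually_steps:
  assumes "g \<in> \<Omega>"
  shows "eventually (\<lambda>s. s \<in> steps g w) (at_right 0)"
proof -
  have "((\<lambda>s. g \<cdot>\<^sub>H h_exp (s *\<^sub>R w)) \<longlongrightarrow> g \<cdot>\<^sub>H h_exp (0 *\<^sub>R w)) (at_right 0)"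
    by (intro tendsto_intros)
  then have "eventually (\<lambda>s. g \<cdot>\<^sub>H h_exp (s *\<^sub>R w) \<in> \<Omega>) (at_right 0)"
    using assms by (intro eventually_in_dom[of _ g]) simp_all
  then show ?thesis
    unfolding steps_def mem_Collect_eq by (intro eventually_conj eventually_at_right_less)
qed

lemma steps_nonempty:
  assumes "g \<in> \<Omega>"
  shows "steps g w \<noteq> {}"
  using eventually_happens'[OF trivial_limit_at_right_real eventually_steps[OF assms]] by blast

lemma diff_quot_mono:
  assumes g: "g \<in> \<Omega>" and s: "s \<in> steps g w" and r: "0 < r" "r \<le> s"
  shows "h_diff_quot w u g r \<le> h_diff_quot w u g s"
proof -
  have s': "0 < s" "g \<cdot>\<^sub>H h_exp (s *\<^sub>R w) \<in> \<Omega>" using s by (simp_all add: steps_def)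
  have "u (g \<cdot>\<^sub>H h_exp ((r / s) *\<^sub>R s *\<^sub>R w)) \<le> u g + (r / s) * (u (g \<cdot>\<^sub>H h_exp (s *\<^sub>R w)) - u g)"
    using r s' by (intro segment_le g) auto
  then have "u (g \<cdot>\<^sub>H h_exp (r *\<^sub>R w)) - u g \<le> r * ((u (g \<cdot>\<^sub>H h_exp (s *\<^sub>R w)) - u g) / s)"
    using s' by simp
  then show ?thesis using r by (simp add: h_diff_quot_def divide_le_eq mult.commute)
qed

text \<open>Three-point inequality: \<open>g\<close> lies on the segment joining the ends of the two
  steps. It bounds the quotients below, so the infimum in \<open>dir_deriv\<close> is
  genuine.\<close>

lemma diff_quot_opposite_le:
  assumes s: "s \<in> steps g w" and r: "r \<in> steps g (- w)"
  shows "- h_diff_quot (- w) u g r \<le> h_diff_quot w u g s"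
proof -
  let ?p = "g \<cdot>\<^sub>H h_exp (r *\<^sub>R (- w))" and ?q = "g \<cdot>\<^sub>H h_exp (s *\<^sub>R w)"
  have pos: "0 < s" "0 < r" and pq: "?p \<in> \<Omega>" "?q \<in> \<Omega>"
    using s r by (simp_all only: steps_def mem_Collect_eq)
  have flow: "?p \<cdot>\<^sub>H h_exp (k *\<^sub>R w) = g \<cdot>\<^sub>H h_exp ((k - r) *\<^sub>R w)" for k
    using h_exp_add_same[of g "- r" w k] by simp
  have q: "?p \<cdot>\<^sub>H h_exp ((r + s) *\<^sub>R w) = ?q" by (simp only: flow) simp
  have "?p \<cdot>\<^sub>H h_exp ((r / (r + s)) *\<^sub>R (r + s) *\<^sub>R w) = g"
    using pos by (simp only: scaleR_scaleR flow) simp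
  moreover have "u (?p \<cdot>\<^sub>H h_exp ((r / (r + s)) *\<^sub>R (r + s) *\<^sub>R w)) \<le>
      u ?p + (r / (r + s)) * (u (?p \<cdot>\<^sub>H h_exp ((r + s) *\<^sub>R w)) - u ?p)"
    by (rule segment_le[OF pq(1)]; (unfold q)?) (use pq pos in simp_all)
  ultimately have "u g \<le> u ?p + (r / (r + s)) * (u ?q - u ?p)" by (simp only: q)
  then have "(r + s) * u g \<le> (r + s) * (u ?p + (r / (r + s)) * (u ?q - u ?p))"
    using pos by (intro mult_left_mono) auto
  also have "\<dots> = s * u ?p + r * u ?q" using pos by (simp add: field_simps)
  finally show ?thesis
    unfolding h_diff_quot_def minus_divide_left using pos
    by (simp only: divide_le_eq pos_divide_le_eq pos_le_divide_eq times_divide_eq_left) (simp add: algebra_simps)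
qed

lemma bdd_below_diff_quot:
  assumes "g \<in> \<Omega>"
  shows "bdd_below (h_diff_quot w u g ` steps g w)"
proof -
  obtain r where "r \<in> steps g (- w)" using steps_nonempty[OF assms] by blast
  then show ?thesis using diff_quot_opposite_le by (intro bdd_belowI2) blast
qed

lemma dir_deriv_le:
  assumes "g \<in> \<Omega>" "s \<in> steps g w"
  shows "dir_deriv g w \<le> h_diff_quot w u g s"
  unfolding dir_deriv_def by (intro cINF_lower bdd_below_diff_quot assms)

lemma le_dir_deriv:
  assumes "g \<in> \<Omega>" "\<And>s. s \<in> steps g w \<Longrightarrow> c \<le> h_diff_quot w u g s"
  shows "c \<le> dir_deriv g w"
  unfolding dir_deriv_def by (intro cINF_greatest steps_nonempty assms)

text \<open>The quotients decrease as the step shrinks, so they converge to their infimum.\<close>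

lemma tendsto_dir_deriv:
  assumes g: "g \<in> \<Omega>"
  shows "(h_diff_quot w u g \<longlongrightarrow> dir_deriv g w) (at_right 0)"
proof (rule order_tendstoI)
  fix c assume "c < dir_deriv g w"
  show "eventually (\<lambda>s. c < h_diff_quot w u g s) (at_right 0)"
    using eventually_steps[OF g, of w]
  proof eventually_elim
    case (elim s)
    show ?case using \<open>c < dir_deriv g w\<close> dir_deriv_le[OF g elim] by (rule less_le_trans)
  qed
next
  fix c assume "dir_deriv g w < c"
  then obtain s where s: "s \<in> steps g w" "h_diff_quot w u g s < c"
    using le_dir_deriv[OF g] by (meson not_less)
  then have "0 < s" by (simp add: steps_def)
  then have "eventually (\<lambda>r. r \<in> {0<..<s}) (at_right 0)"
    by (rule eventually_at_right_real)
  then show "eventually (\<lambda>r. h_diff_quot w u g r < c) (at_right 0)"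
  proof eventually_elim
    case (elim r)
    then show ?case using diff_quot_mono[OF g s(1), of r] s(2) by auto
  qed
qed

lemma dir_deriv_zero: "g \<in> \<Omega> \<Longrightarrow> dir_deriv g 0 = 0"
  using tendsto_dir_deriv[of g 0] by (simp add: h_diff_quot_def tendsto_const_iff)

lemma dir_deriv_scaleR:
  assumes g: "g \<in> \<Omega>" and "0 \<le> c"
  shows "dir_deriv g (c *\<^sub>R w) = c * dir_deriv g w"
proof (cases "c = 0")
  case True
  then show ?thesis using dir_deriv_zero[OF g] by simp
next
  case False
  then have c: "0 < c" using assms by simp
  have "filterlim (\<lambda>s. c * s) (at_right 0) (at_right (0::real))"
    by (rule filterlim_times_pos[OF filterlim_ident c]) simp
  then have "((\<lambda>s. c * h_diff_quot w u g (c * s)) \<longlongrightarrow> c * dir_deriv g w) (at_right 0)"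
    by (intro tendsto_mult_left filterlim_compose[OF tendsto_dir_deriv[OF g]])
  moreover have "(\<lambda>s. c * h_diff_quot w u g (c * s)) = h_diff_quot (c *\<^sub>R w) u g"
    using c by (simp add: h_diff_quot_def fun_eq_iff mult.commute)
  ultimately show ?thesis
    using tendsto_unique[OF trivial_limit_at_right_real tendsto_dir_deriv[OF g]] by metis
qed

text \<open>The steps \<open>\<mu>\<close> and \<open>\<nu>\<close> stay fixed while the path
  shrinks, since \<open>tendsto_u\<close> gives convergence of quotients of fixed step at moving
  base points. The infima over both are taken only at the end.\<close>

lemma dir_deriv_add_le:
  assumes g: "g \<in> \<Omega>"
  shows "dir_deriv g (v + w) \<le> dir_deriv g v + dir_deriv g w"
proof -
  have le: "dir_deriv g (v + w) \<le> h_diff_quot v u g \<mu> + h_diff_quot w u g \<nu>"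
    if \<mu>: "\<mu> \<in> steps g v" and \<nu>: "\<nu> \<in> steps g w" for \<mu> \<nu>
  proof -
    \<comment> \<open>\<open>p s\<close> and \<open>q s\<close> are the inner vertices of the path
      along \<open>v\<close>, \<open>2 w\<close>, \<open>v\<close> at scale \<open>s\<close>; it
      ends at step \<open>2 * s\<close> in direction \<open>v + w\<close>.\<close>
    define p where "p s = g \<cdot>\<^sub>H h_exp (s *\<^sub>R v)" for s
    define q where "q s = p s \<cdot>\<^sub>H h_exp (2 *\<^sub>R (s *\<^sub>R w))" for s
    have \<mu>': "0 < \<mu>" "g \<cdot>\<^sub>H h_exp (\<mu> *\<^sub>R v) \<in> \<Omega>" and \<nu>': "0 < \<nu>" "g \<cdot>\<^sub>H h_exp (\<nu> *\<^sub>R w) \<in> \<Omega>"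
      using \<mu> \<nu> by (simp_all add: steps_def)
    have "(p \<longlongrightarrow> g \<cdot>\<^sub>H h_exp (0 *\<^sub>R v)) (at_right 0)"
      unfolding p_def by (intro tendsto_intros)
    then have p: "(p \<longlongrightarrow> g) (at_right 0)" by simp
    have "(q \<longlongrightarrow> g \<cdot>\<^sub>H h_exp (2 *\<^sub>R (0 *\<^sub>R w))) (at_right 0)"
      unfolding q_def by (intro tendsto_intros p)
    then have q: "(q \<longlongrightarrow> g) (at_right 0)" by simp
    have pw: "((\<lambda>s. p s \<cdot>\<^sub>H h_exp (\<nu> *\<^sub>R w)) \<longlongrightarrow> g \<cdot>\<^sub>H h_exp (\<nu> *\<^sub>R w)) (at_right 0)"
      by (intro tendsto_intros p)
    have qv: "((\<lambda>s. q s \<cdot>\<^sub>H h_exp (\<mu> *\<^sub>R v)) \<longlongrightarrow> g \<cdot>\<^sub>H h_exp (\<mu> *\<^sub>R v)) (at_right 0)"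
      by (intro tendsto_intros q)
    \<comment> \<open>Mean slope of the path: the middle piece has twice the length, hence the
      weight 2, and the total increment is at most \<open>2 * s * B s\<close>.\<close>
    define B where "B s = (h_diff_quot v u g \<mu> + 2 * h_diff_quot w u (p s) \<nu> + h_diff_quot v u (q s) \<mu>) / 2" for s
    have "(B \<longlongrightarrow> (h_diff_quot v u g \<mu> + 2 * h_diff_quot w u g \<nu> + h_diff_quot v u g \<mu>) / 2) (at_right 0)"
      unfolding B_def h_diff_quot_def
      using \<mu>' \<nu>' by (intro tendsto_intros tendsto_u[OF p g] tendsto_u[OF q g] tendsto_u[OF pw] tendsto_u[OF qv]) auto
    moreover have "(h_diff_quot v u g \<mu> + 2 * h_diff_quot w u g \<nu> + h_diff_quot v u g \<mu>) / 2 =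
        h_diff_quot v u g \<mu> + h_diff_quot w u g \<nu>"
      by (simp add: field_simps)
    ultimately have B: "(B \<longlongrightarrow> h_diff_quot v u g \<mu> + h_diff_quot w u g \<nu>) (at_right 0)"
      by (simp only:)
    have "eventually (\<lambda>s. p s \<in> \<Omega> \<and> q s \<in> \<Omega> \<and> p s \<cdot>\<^sub>H h_exp (\<nu> *\<^sub>R w) \<in> \<Omega> \<and> q s \<cdot>\<^sub>H h_exp (\<mu> *\<^sub>R v) \<in> \<Omega>) (at_right 0)"
      using eventually_in_dom[OF p g] eventually_in_dom[OF q g] eventually_in_dom[OF pw \<nu>'(2)]
        eventually_in_dom[OF qv \<mu>'(2)]
      by (intro eventually_conj)
    \<comment> \<open>The pieces have steps \<open>s\<close>, \<open>2 * s\<close>,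
      \<open>s\<close>; below \<open>\<mu>\<close> and \<open>\<nu>\<close>, monotonicity bounds
      their quotients by the fixed ones.\<close>
    moreover have "eventually (\<lambda>s. s \<in> {0<..<min \<mu> (\<nu> / 2)}) (at_right 0)"
      using \<mu>' \<nu>' by (intro eventually_at_right_real) simp
    moreover have "((\<lambda>s. g \<cdot>\<^sub>H h_exp (2 *\<^sub>R (s *\<^sub>R (v + w)))) \<longlongrightarrow> g \<cdot>\<^sub>H h_exp (2 *\<^sub>R (0 *\<^sub>R (v + w)))) (at_right 0)"
      by (intro tendsto_intros)
    then have "eventually (\<lambda>s. g \<cdot>\<^sub>H h_exp (2 *\<^sub>R (s *\<^sub>R (v + w))) \<in> \<Omega>) (at_right 0)"
      using g by (intro eventually_in_dom[of _ g]) simp_all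
    ultimately have "eventually (\<lambda>s. dir_deriv g (v + w) \<le> B s) (at_right 0)"
    proof eventually_elim
      case (elim s)
      then have s: "0 < s" "s \<le> \<mu>" "2 * s \<le> \<nu>" by auto
      have "q s \<cdot>\<^sub>H h_exp (s *\<^sub>R v) = g \<cdot>\<^sub>H h_exp (2 *\<^sub>R (s *\<^sub>R v + s *\<^sub>R w))"
        unfolding q_def p_def by (rule h_exp_symmetric_product)
      then have r: "q s \<cdot>\<^sub>H h_exp (s *\<^sub>R v) = g \<cdot>\<^sub>H h_exp ((2 * s) *\<^sub>R (v + w))"
        by (simp add: scaleR_add_right)
      have "2 * s \<in> steps g (v + w)" using elim s by (simp add: steps_def)
      from dir_deriv_le[OF g this]
      have "2 * s * dir_deriv g (v + w) \<le> u (g \<cdot>\<^sub>H h_exp ((2 * s) *\<^sub>R (v + w))) - u g"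
        using s by (simp add: h_diff_quot_def pos_le_divide_eq mult.commute)
      also have "\<dots> = (u (p s) - u g) + (u (q s) - u (p s)) + (u (q s \<cdot>\<^sub>H h_exp (s *\<^sub>R v)) - u (q s))"
        by (simp add: r)
      also have "\<dots> \<le> s * h_diff_quot v u g \<mu> + 2 * s * h_diff_quot w u (p s) \<nu> + s * h_diff_quot v u (q s) \<mu>"
      proof (intro add_mono)
        have inc: "u (z \<cdot>\<^sub>H h_exp (k *\<^sub>R y)) - u z \<le> k * h_diff_quot y u z m"
          if "z \<in> \<Omega>" "z \<cdot>\<^sub>H h_exp (m *\<^sub>R y) \<in> \<Omega>" "0 < k" "k \<le> m" for z y k m
        proof -
          have "(u (z \<cdot>\<^sub>H h_exp (k *\<^sub>R y)) - u z) / k \<le> h_diff_quot y u z m"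
            using diff_quot_mono[OF that(1) _ that(3,4), of y] that
            by (simp add: steps_def fun_cong[OF h_diff_quot_def, of y u z k])
          then show ?thesis using \<open>0 < k\<close> by (simp add: pos_divide_le_eq mult.commute)
        qed
        show "u (p s) - u g \<le> s * h_diff_quot v u g \<mu>"
          unfolding p_def using \<mu>' s by (intro inc g)
        show "u (q s \<cdot>\<^sub>H h_exp (s *\<^sub>R v)) - u (q s) \<le> s * h_diff_quot v u (q s) \<mu>"
          using elim s by (intro inc) auto
        show "u (q s) - u (p s) \<le> 2 * s * h_diff_quot w u (p s) \<nu>"
          unfolding q_def scaleR_scaleR using elim s by (intro inc) auto
      qed
      also have "\<dots> = 2 * s * B s" by (simp add: B_def algebra_simps)
      finally show ?case using s by simp
    qed
    then show ?thesis
      using tendsto_lowerbound[OF B _ trivial_limit_at_right_real] by blast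
  qed
  have "dir_deriv g (v + w) - h_diff_quot w u g \<nu> \<le> dir_deriv g v" if "\<nu> \<in> steps g w" for \<nu>
    using le that by (intro le_dir_deriv[OF g]) (simp add: diff_le_eq)
  then have "dir_deriv g (v + w) - dir_deriv g v \<le> dir_deriv g w"
    by (intro le_dir_deriv[OF g]) (simp add: algebra_simps)
  then show ?thesis by simp
qed

section \<open>Subgradients and derivatives in terms of the directional derivative\<close>

text \<open>Dividing the subgradient inequality at \<open>s *\<^sub>R w\<close> by \<open>s\<close>
  and taking the infimum gives one direction; the step 1 gives the other.\<close>

lemma mem_h_subdiff_iff:
  assumes g: "g \<in> \<Omega>"
  shows "p \<in> h_subdiff \<Omega> u g \<longleftrightarrow> (\<forall>w. inner p w \<le> dir_deriv g w)"
proof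
  assume "p \<in> h_subdiff \<Omega> u g"
  then have sub: "u g + inner p w \<le> u (g \<cdot>\<^sub>H h_exp w)" if "g \<cdot>\<^sub>H h_exp w \<in> \<Omega>" for w
    using that unfolding h_subdiff_def mem_Collect_eq ball_h_plane xi1_exp_diff by blast
  show "\<forall>w. inner p w \<le> dir_deriv g w"
  proof (intro allI le_dir_deriv[OF g])
    fix w s assume "s \<in> steps g w"
    then show "inner p w \<le> h_diff_quot w u g s"
      using sub[of "s *\<^sub>R w"] by (simp add: steps_def h_diff_quot_def pos_le_divide_eq mult.commute)
  qed
next
  assume *: "\<forall>w. inner p w \<le> dir_deriv g w"
  have "u g + inner p w \<le> u (g \<cdot>\<^sub>H h_exp w)" if "g \<cdot>\<^sub>H h_exp w \<in> \<Omega>" for w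
  proof -
    have "1 \<in> steps g w" using that by (simp add: steps_def)
    from dir_deriv_le[OF g this] have "dir_deriv g w \<le> u (g \<cdot>\<^sub>H h_exp w) - u g"
      by (simp add: h_diff_quot_def)
    with * show ?thesis by (smt (verit))
  qed
  then show "p \<in> h_subdiff \<Omega> u g"
    unfolding h_subdiff_def mem_Collect_eq ball_h_plane xi1_exp_diff by blast
qed

text \<open>The left-hand quotient along \<open>w\<close> is minus the right-hand quotient along
  \<open>- w\<close>, so differentiability along \<open>w\<close> is oddness of
  \<open>dir_deriv g\<close> there.\<close>

lemma tendsto_diff_quot_iff:
  assumes g: "g \<in> \<Omega>"
  shows "(h_diff_quot w u g \<longlongrightarrow> d) (at 0) \<longleftrightarrow> dir_deriv g w = d \<and> dir_deriv g (- w) = - d"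
proof -
  have right: "(h_diff_quot v u g \<longlongrightarrow> c) (at_right 0) \<longleftrightarrow> dir_deriv g v = c" for v c
    using tendsto_dir_deriv[OF g, of v] tendsto_unique[OF trivial_limit_at_right_real] by blast
  have "h_diff_quot w u g (- s) = - h_diff_quot (- w) u g s" for s
    by (simp add: h_diff_quot_def)
  then have "(h_diff_quot w u g \<longlongrightarrow> d) (at_left 0) \<longleftrightarrow> (h_diff_quot (- w) u g \<longlongrightarrow> - d) (at_right 0)"
    by (simp add: filterlim_at_left_to_right[of _ _ 0] tendsto_minus_cancel_left)
  then show ?thesis unfolding filterlim_at_split right by blast
qed

end

section \<open>Hahn-Banach in the plane\<close>

text \<open>One-step extension: the functional is prescribed as \<open>D v\<close> on
  \<open>v\<close>, and its value \<open>c\<close> on \<open>v'\<close> has to be found.\<close>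

lemma sublinear_support:
  fixes D :: "'a::real_inner \<Rightarrow> real"
  assumes add: "\<And>v w. D (v + w) \<le> D v + D w"
    and scale: "\<And>c w. 0 \<le> c \<Longrightarrow> D (c *\<^sub>R w) = c * D w"
    and v: "inner v v = 1" "inner v v' = 0" "inner v' v' = 1"
    and basis: "\<And>w. w = inner w v *\<^sub>R v + inner w v' *\<^sub>R v'"
  obtains p where "\<And>w. inner p w \<le> D w" "inner p v = D v"
proof -
  have D0: "D 0 = 0" using scale[of 0 0] by simp
  have line: "a * D v \<le> D (a *\<^sub>R v)" for a
  proof (cases "0 \<le> a")
    case False
    have "0 \<le> D (a *\<^sub>R v) + D ((- a) *\<^sub>R v)" using add[of "a *\<^sub>R v" "(- a) *\<^sub>R v"] D0 by simp
    then show ?thesis using scale[of "- a" v] False by simp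
  qed (simp add: scale)
  \<comment> \<open>Every lower bound imposed on \<open>c\<close> from the side of
    \<open>- v'\<close> is below every upper bound from the side of \<open>v'\<close>; the supremum
    of the lower bounds is then admissible.\<close>
  have gap: "a * D v - D (a *\<^sub>R v - v') \<le> D (b *\<^sub>R v + v') - b * D v" for a b
    using line[of "a + b"] add[of "a *\<^sub>R v - v'" "b *\<^sub>R v + v'"] by (simp add: algebra_simps)
  define c where "c = (SUP a. a * D v - D (a *\<^sub>R v - v'))"
  have lower: "a * D v - D (a *\<^sub>R v - v') \<le> c" for a
    unfolding c_def by (intro cSUP_upper bdd_aboveI2[of _ _ "D (0 *\<^sub>R v + v') - 0 * D v"] gap) simp
  have upper: "c \<le> D (b *\<^sub>R v + v') - b * D v" for b
    unfolding c_def by (intro cSUP_least gap) simp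
  have le: "a * D v + b * c \<le> D (a *\<^sub>R v + b *\<^sub>R v')" for a b
  proof (cases b "0::real" rule: linorder_cases)
    case equal
    then show ?thesis using line by simp
  next
    \<comment> \<open>Homogeneity reduces to coefficient 1 or -1 on \<open>v'\<close>:
      \<open>upper\<close> is scaled by \<open>b\<close> here, \<open>lower\<close> by
      \<open>- b\<close> in the negative case.\<close>
    case greater
    have "b * c \<le> b * (D ((a / b) *\<^sub>R v + v') - (a / b) * D v)"
      using upper[of "a / b"] greater by (intro mult_left_mono) simp_all
    also have "\<dots> = D (b *\<^sub>R ((a / b) *\<^sub>R v + v')) - a * D v"
      using greater scale[of b "(a / b) *\<^sub>R v + v'"] by (simp add: right_diff_distrib)
    finally show ?thesis using greater by (simp add: scaleR_add_right)
  next
    case less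
    have "(- b) * ((a / - b) * D v - D ((a / - b) *\<^sub>R v - v')) \<le> (- b) * c"
      using lower[of "a / - b"] less by (intro mult_left_mono) simp_all
    moreover have "(- b) * D ((a / - b) *\<^sub>R v - v') = D ((- b) *\<^sub>R ((a / - b) *\<^sub>R v - v'))"
      using less by (intro scale[symmetric]) simp
    moreover have "(- b) *\<^sub>R ((a / - b) *\<^sub>R v - v') = a *\<^sub>R v + b *\<^sub>R v'"
      using less by (simp add: scaleR_diff_right)
    ultimately show ?thesis using less by (simp add: right_diff_distrib)
  qed
  show thesis
  proof
    show "inner (D v *\<^sub>R v + c *\<^sub>R v') w \<le> D w" for w
    proof -
      have "inner (D v *\<^sub>R v + c *\<^sub>R v') w = inner w v * D v + inner w v' * c"
        by (simp add: inner_add_left inner_commute[of w v] inner_commute[of w v'])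
      also have "\<dots> \<le> D w"
        using le[of "inner w v" "inner w v'"] unfolding basis[symmetric] .
      finally show ?thesis .
    qed
    show "inner (D v *\<^sub>R v + c *\<^sub>R v') v = D v"
      using v by (simp add: inner_add_left inner_commute[of v' v])
  qed
qed

context h_convex_function
begin

text \<open>The unit vector is completed to an orthonormal basis by a quarter turn. Besides
  nonemptiness of the subdifferential, this gives a subgradient that is extremal in a chosen
  direction.\<close>

lemma exists_subgradient_attaining:
  assumes g: "g \<in> \<Omega>" and v: "norm v = 1"
  obtains p where "p \<in> h_subdiff \<Omega> u g" "inner p v = dir_deriv g v"
proof -
  obtain x y where xy: "v = (x, y)" by (cases v)
  have unit: "x * x + y * y = 1"
    using v by (simp add: xy norm_Pair power2_eq_square)
  have basis: "w = inner w (x, y) *\<^sub>R (x, y) + inner w (- y, x) *\<^sub>R (- y, x)" for w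
  proof -
    obtain a b where w: "w = (a, b)" by (cases w)
    have "a = (a * x + b * y) * x + (b * x - a * y) * (- y)" "b = (a * x + b * y) * y + (b * x - a * y) * x"
      using unit by algebra+
    then show ?thesis by (simp add: w)
  qed
  have orthonormal: "inner (x, y) (x, y) = 1" "inner (x, y) (- y, x) = 0" "inner (- y, x) (- y, x) = 1"
    using unit by (simp_all add: add.commute)
  show thesis
  proof (rule sublinear_support[OF dir_deriv_add_le[OF g] dir_deriv_scaleR[OF g] orthonormal basis])
    fix p assume "\<And>w. inner p w \<le> dir_deriv g w" "inner p (x, y) = dir_deriv g (x, y)"
    then show thesis unfolding xy[symmetric] by (intro that) (simp_all only: mem_h_subdiff_iff[OF g] simp_thms)
  qed
qed

end

section \<open>Horizontal differentiability and uniqueness of the subgradient\<close>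

theorem theorem4p2:
  fixes \<Omega> :: "heis set" and u :: "heis \<Rightarrow> real" and g :: heis
  assumes "open \<Omega>" and "h_convex \<Omega>" and "h_convex_on \<Omega> u" and "g \<in> \<Omega>"
  shows "(X_differentiable u g \<and> Y_differentiable u g \<longleftrightarrow> (\<exists>!p. p \<in> h_subdiff \<Omega> u g)) \<and>
    ((X_differentiable u g \<and> Y_differentiable u g) \<or> (\<exists>!p. p \<in> h_subdiff \<Omega> u g) \<longrightarrow>
      h_subdiff \<Omega> u g = {h_grad u g})"
proof -
  interpret h_convex_function \<Omega> u using assms by unfold_locales
  note g = \<open>g \<in> \<Omega>\<close>
  have unit: "norm X_field = 1" "norm Y_field = 1"
    by (simp_all add: X_field_def Y_field_def norm_Pair)
  have X_iff: "X_differentiable u g \<longleftrightarrow> dir_deriv g (- X_field) = - dir_deriv g X_field"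
    unfolding X_differentiable_def tendsto_diff_quot_iff[OF g] by blast
  have Y_iff: "Y_differentiable u g \<longleftrightarrow> dir_deriv g (- Y_field) = - dir_deriv g Y_field"
    unfolding Y_differentiable_def tendsto_diff_quot_iff[OF g] by blast
  have grad: "h_subdiff \<Omega> u g = {h_grad u g}" if X: "X_differentiable u g" and Y: "Y_differentiable u g"
  proof -
    have lim: "X_deriv u g = dir_deriv g X_field" "Y_deriv u g = dir_deriv g Y_field"
      using X Y unfolding X_deriv_def Y_deriv_def X_iff Y_iff
      by (simp_all add: tendsto_Lim tendsto_diff_quot_iff[OF g])
    have "p = h_grad u g" if "p \<in> h_subdiff \<Omega> u g" for p
    proof -
      have le: "inner p w \<le> dir_deriv g w" for w
        using that mem_h_subdiff_iff[OF g] by blast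
      \<comment> \<open>Oddness turns the inequalities along a basis vector and its negative into
        equality, which fixes both coordinates of \<open>p\<close>.\<close>
      have "inner p X_field = dir_deriv g X_field" "inner p Y_field = dir_deriv g Y_field"
        using le[of X_field] le[of "- X_field"] le[of Y_field] le[of "- Y_field"] X Y
        by (simp_all add: X_iff Y_iff)
      then show ?thesis
        by (cases p) (simp add: h_grad_def lim X_field_def Y_field_def)
    qed
    moreover obtain p where "p \<in> h_subdiff \<Omega> u g"
      using exists_subgradient_attaining[OF g unit(1)] by blast
    ultimately show ?thesis by blast
  qed
  \<comment> \<open>Subgradients extremal along \<open>v\<close> and along \<open>- v\<close> both
    exist; if they coincide, the two directional derivatives are opposite.\<close>
  have odd: "dir_deriv g (- v) = - dir_deriv g v"
    if unique: "\<exists>!p. p \<in> h_subdiff \<Omega> u g" and "norm v = 1" for v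
  proof -
    obtain p where p: "p \<in> h_subdiff \<Omega> u g" "inner p v = dir_deriv g v"
      using exists_subgradient_attaining[OF g \<open>norm v = 1\<close>] .
    have "norm (- v) = 1" using \<open>norm v = 1\<close> by simp
    then obtain q where q: "q \<in> h_subdiff \<Omega> u g" "inner q (- v) = dir_deriv g (- v)"
      using exists_subgradient_attaining[OF g] by blast
    have "p = q" using unique p(1) q(1) by blast
    then show ?thesis using p(2) q(2) by simp
  qed
  have "X_differentiable u g \<and> Y_differentiable u g" if "\<exists>!p. p \<in> h_subdiff \<Omega> u g"
    using odd[OF that] unit by (simp add: X_iff Y_iff)
  moreover have "\<exists>!p. p \<in> h_subdiff \<Omega> u g" if "X_differentiable u g" "Y_differentiable u g"
    unfolding grad[OF that] by blast
  ultimately show ?thesis using grad by (intro conjI) (iprover, iprover)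
qed

end
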